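(* Consider the mean-field game with impulse controls (MFG) described in the context, with $b=0$ and constant volatility, and suppose the following assumptions hold. (A1) The uncontrolled dynamics are $dX_t=\sigma\,dW_t$, $X_{0-}\sim\mu$, where $\sigma>0$ is a constant and $\mu$, with $\int_{\mathbb{R}}|x|\mu(dx)<\infty$, is symmetric around its mean. (A2) The cost of control $\phi:\mathbb{R}\to\mathbb{R}$ satisfies: $K:=\inf_{\xi\in\mathbb{R}}\phi(\xi)>0$; $\phi\in C(\mathbb{R}\setminus\{0\})$; $\lim_{|\xi|\to\infty}\phi(\xi)=+\infty$ and $\sup_{\xi\in\mathbb{R}}\frac{\phi(\xi)}{1+|\xi|}\le k$ for some $k>0$; $\phi(\xi_1)+\phi(\xi_2)\ge\phi(\xi_1+\xi_2)+K$ for all $\xi_1,\xi_2\in\mathbb{R}$; $\phi(-\xi)=\phi(\xi)$ for all $\xi\in\mathbb{R}$. (A3) The running cost $f:\mathbb{R}\times\mathbb{R}\to\mathbb{R}$ is jointly continuous with $f\ge0$, and for each fixed $m\in\mathbb{R}$: there is $C_f=C_f(m)>0$ with $|f(x,m)-f(y,m)|<C_f|x-y|$ for all $x, y\in\mathbb{R}$ with $x\neq y$; and $f(m+\delta,m)=f(m-\delta,m)$ for all $\delta\in\mathbb{R}$. (A4) For each fixed $m\in\mathbb{R}$, the strategy $\tilde\varphi(m)=(A_m,\xi_m)$ defined by $$A_m=\{x\in\mathbb{R}:\mathcal{M}V(x|m)-V(x|m)=0\},\qquad \xi_m(x)=\arg\min_{\delta\in\mathbb{R}}\{V(x+\delta|m)+\phi(\delta)\}$$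 is admissible and is the unique strategy $\varphi$ such that $V(x|m)=J_\infty(x,\varphi|m)$. Then (MFG) admits a solution $(\varphi^*,m^* )$.
   Context: **The game (MFG).** $(\Omega,\mathcal{F},\{\mathcal{F}_t\}_{t\ge0},\mathbb{P})$ is a filtered probability space supporting an adapted standard real Brownian motion $W$; $\mu$ is a probability distribution on $\mathbb{R}$ (initial distribution); $r>0$ is the discount rate. $\mathcal{A}$ denotes the set of admissible impulse controls; a control is a pair $\varphi=(A,\xi)$ with $A\subseteq\mathbb{R}$ closed (action region) and $\xi:\mathbb{R}\to\mathbb{R}$ measurable (impulse function), for which the objects below are well defined. Under $\varphi$, the state process is $$dX_t=b(X_{t-})dt+\sigma(X_{t-})dW_t+\sum_{n\ge1}\delta(t-\tau_n)\xi_n,\qquad X_{0-}\sim\mu,$$ with $\delta(\cdot)$ the Dirac function (i.e. $X$ jumps by $\xi_n$ at time $\tau_n$), where $\tau_1=\inf\{t\ge0:X_{t-}\in A\}$, $\tau_n=\inf\{t>\tau_{n-1}:X_{t-}\in A\}$ for $n\ge2$, and $\xi_n=\xi(X_{\tau_n-})$. The control policy is also characterized by the sequence $\{(\tau_n,\xi_n)\}_{n\ge1}$. For $m\in\mathbb{R}$ (the mean information), $$J_\infty(x,\varphi|m)=\mathbb{E}_\mu\Big[\int_0^\infty e^{-rt}f(X_t,m)dt+\sum_{n\ge1}e^{-r\tau_n}\phi(\xi_n)\,\Big|\,X_{0-}=x\Big],\qquad V(x|m)=\inf_{\varphi\in\mathcal{A}}J_\infty(x,\varphi|m),$$ $$\mathcal{M}V(x|m)=\inf_{\delta\in\mathbb{R}}\{V(x+\delta|m)+\phi(\delta)\}.$$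 **Solution.** A pair $(\varphi^*=(A^*,\xi^* ),m^* )$ with $\varphi^*\in\mathcal{A}$ and $m^*\in\mathbb{R}$ is a solution to (MFG) if $V(x|m^* )=J_\infty(x,\varphi^*|m^* )$ for all $x \in \mathbb{R}$ and $m^*=\limsup_{t\to\infty}\mathbb{E}_\mu[X_t^*]$, where $X^*$ is the state process controlled by $\varphi^*$ with $X^*_{0-}\sim\mu$. *)

theory Defs
  imports "HOL-Probability.Probability"
begin

text \<open>Driving noise. Time is \<open>[0, \<infinity>)\<close>; the values of \<open>F\<close> and \<open>W\<close> at negative arguments are irrelevant.\<close>

locale filtered_prob_space = prob_space M for M :: "'a measure" +
  fixes F :: "real \<Rightarrow> 'a measure"
  assumes subalgebra_F: "0 \<le> t \<Longrightarrow> subalgebra M (F t)"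
    and F_mono: "0 \<le> s \<Longrightarrow> s \<le> t \<Longrightarrow> subalgebra (F t) (F s)"

locale adapted_brownian_motion = filtered_prob_space M F
  for M :: "'a measure" and F :: "real \<Rightarrow> 'a measure" +
  fixes W :: "real \<Rightarrow> 'a \<Rightarrow> real"
  assumes adapted: "0 \<le> t \<Longrightarrow> W t \<in> borel_measurable (F t)"
    and start: "AE \<omega> in M. W 0 \<omega> = 0"
    and gaussian_increments: "0 \<le> s \<Longrightarrow> s < t \<Longrightarrow>
      distributed M lborel (\<lambda>\<omega>. W t \<omega> - W s \<omega>) (normal_density 0 (sqrt (t - s)))"
    and independent_increments: "0 \<le> s \<Longrightarrow> s < t \<Longrightarrow>
      indep_set (sets (F s)) (sets (vimage_algebra (space M) (\<lambda>\<omega>. W t \<omega> - W s \<omega>) borel))"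
    and continuous_paths: "\<omega> \<in> space M \<Longrightarrow> continuous_on {0..} (\<lambda>t. W t \<omega>)"

text \<open>A control \<open>(A, \<xi>)\<close>: action region and impulse function.\<close>

type_synonym control = "real set \<times> (real \<Rightarrow> real)"

text \<open>
  The controlled dynamics are defined pathwise, from the uncontrolled path
  \<open>y t = X\<^sub>0\<^sub>- + \<sigma> W\<^sub>t\<close>. Since there is no drift and the volatility is constant, between
  interventions the state is \<open>y\<close> plus the accumulated impulses. Interventions are numbered from 0
  instead of 1. \<open>stage (A, \<xi>) y n\<close> consists of the time of intervention \<open>n\<close> (\<open>\<infinity>\<close> if it does not
  take place) and the sum \<open>s\<close> of the impulses before it. On \<open>[0, \<tau>\<^sub>0]\<close>, respectively on
  \<open>(\<tau>\<^sub>n\<^sub>-\<^sub>1, \<tau>\<^sub>n]\<close>, the left limit \<open>X\<^sub>t\<^sub>-\<close> is \<open>y t + s\<close>, so that the infima below are those of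
  \<open>{t \<ge> 0. X\<^sub>t\<^sub>- \<in> A}\<close> and of \<open>{t > \<tau>\<^sub>n. X\<^sub>t\<^sub>- \<in> A}\<close>.
\<close>

primrec stage :: "control \<Rightarrow> (real \<Rightarrow> real) \<Rightarrow> nat \<Rightarrow> ereal \<times> real" where
  "stage u y 0 = (Inf {ereal t | t. 0 \<le> t \<and> y t \<in> fst u}, 0)"
| "stage u y (Suc n) =
    (let \<tau> = fst (stage u y n); s = snd (stage u y n); s' = s + snd u (y (real_of_ereal \<tau>) + s)
     in (Inf {ereal t | t. 0 \<le> t \<and> \<tau> < ereal t \<and> y t + s' \<in> fst u}, s'))"

definition itime :: "control \<Rightarrow> (real \<Rightarrow> real) \<Rightarrow> nat \<Rightarrow> ereal" where
  "itime u y n = fst (stage u y n)"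

definition impulse :: "control \<Rightarrow> (real \<Rightarrow> real) \<Rightarrow> nat \<Rightarrow> real" where
  "impulse u y n = snd u (y (real_of_ereal (itime u y n)) + snd (stage u y n))"

definition state :: "control \<Rightarrow> (real \<Rightarrow> real) \<Rightarrow> real \<Rightarrow> real" where
  "state u y t = y t + (\<Sum>n | itime u y n \<le> ereal t. impulse u y n)"

text \<open>
  The state is defined for all times iff the interventions do not accumulate. If
  \<open>\<tau>\<^sub>n\<^sub>+\<^sub>1 = \<tau>\<^sub>n < \<infinity>\<close>, which happens when the state is moved back into \<open>A\<close>, the same left limit
  triggers infinitely many interventions at a single time, so this is excluded as well.
\<close>

definition well_posed :: "control \<Rightarrow> (real \<Rightarrow> real) \<Rightarrow> bool" where
  "well_posed u y \<longleftrightarrow>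
    (\<forall>n. itime u y n < \<infinity> \<longrightarrow> itime u y n < itime u y (Suc n)) \<and> itime u y \<longlonglongrightarrow> \<infinity>"

definition free_path :: "(real \<Rightarrow> 'a \<Rightarrow> real) \<Rightarrow> real \<Rightarrow> ('a \<Rightarrow> real) \<Rightarrow> 'a \<Rightarrow> real \<Rightarrow> real" where
  "free_path W \<sigma> X0 \<omega> t = X0 \<omega> + \<sigma> * W t \<omega>"

text \<open>
  Admissible controls are those for which the objects of the game make sense: the state process
  from every deterministic start (entering the cost) and from \<open>X0\<close> (with the initial distribution),
  and the mean of the latter. The cost needs no condition, being a \<open>[0, \<infinity>]\<close>-valued integral.
\<close>

definition admissible :: "'a measure \<Rightarrow> (real \<Rightarrow> 'a \<Rightarrow> real) \<Rightarrow> ('a \<Rightarrow> real) \<Rightarrow> real \<Rightarrow> control set" where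
  "admissible M W X0 \<sigma> = {u. closed (fst u) \<and> snd u \<in> borel_measurable borel \<and>
     (\<forall>x. AE \<omega> in M. well_posed u (free_path W \<sigma> (\<lambda>_. x) \<omega>)) \<and>
     (AE \<omega> in M. well_posed u (free_path W \<sigma> X0 \<omega>)) \<and>
     (\<forall>t\<ge>0. integrable M (\<lambda>\<omega>. state u (free_path W \<sigma> X0 \<omega>) t))}"

text \<open>
  \<open>path_cost\<close> is meant for a running cost \<open>f \<ge> 0\<close> and a control cost \<open>\<phi> > 0\<close>, on which the
  embedding \<open>ennreal\<close> is faithful. In \<open>cost\<close>, the expectation given \<open>X\<^sub>0\<^sub>- = x\<close> is that of the
  process started at \<open>x\<close>, which is defined for all \<open>x\<close>, also outside the support of the initial
  distribution.
\<close>

definition path_cost :: "real \<Rightarrow> (real \<Rightarrow> real \<Rightarrow> real) \<Rightarrow> (real \<Rightarrow> real) \<Rightarrow>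
    control \<Rightarrow> real \<Rightarrow> (real \<Rightarrow> real) \<Rightarrow> ennreal" where
  "path_cost r f \<phi> u m y =
     (\<integral>\<^sup>+ t\<in>{0..}. ennreal (exp (- r * t) * f (state u y t) m) \<partial>lborel) +
     (\<Sum>n. if itime u y n = \<infinity> then 0
           else ennreal (exp (- r * real_of_ereal (itime u y n)) * \<phi> (impulse u y n)))"

definition cost :: "'a measure \<Rightarrow> (real \<Rightarrow> 'a \<Rightarrow> real) \<Rightarrow> real \<Rightarrow> real \<Rightarrow>
    (real \<Rightarrow> real \<Rightarrow> real) \<Rightarrow> (real \<Rightarrow> real) \<Rightarrow> real \<Rightarrow> control \<Rightarrow> real \<Rightarrow> ennreal" where
  "cost M W \<sigma> r f \<phi> x u m = (\<integral>\<^sup>+ \<omega>. path_cost r f \<phi> u m (free_path W \<sigma> (\<lambda>_. x) \<omega>) \<partial>M)"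

definition value_fun :: "'a measure \<Rightarrow> (real \<Rightarrow> 'a \<Rightarrow> real) \<Rightarrow> ('a \<Rightarrow> real) \<Rightarrow> real \<Rightarrow> real \<Rightarrow>
    (real \<Rightarrow> real \<Rightarrow> real) \<Rightarrow> (real \<Rightarrow> real) \<Rightarrow> real \<Rightarrow> real \<Rightarrow> ennreal" where
  "value_fun M W X0 \<sigma> r f \<phi> x m = (INF u \<in> admissible M W X0 \<sigma>. cost M W \<sigma> r f \<phi> x u m)"

definition intervention_op :: "(real \<Rightarrow> real) \<Rightarrow> (real \<Rightarrow> ennreal) \<Rightarrow> real \<Rightarrow> ennreal" where
  "intervention_op \<phi> V x = (INF \<delta>. V (x + \<delta>) + ennreal (\<phi> \<delta>))"

definition optimal :: "'a measure \<Rightarrow> (real \<Rightarrow> 'a \<Rightarrow> real) \<Rightarrow> ('a \<Rightarrow> real) \<Rightarrow> real \<Rightarrow> real \<Rightarrow>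
    (real \<Rightarrow> real \<Rightarrow> real) \<Rightarrow> (real \<Rightarrow> real) \<Rightarrow> control \<Rightarrow> real \<Rightarrow> bool" where
  "optimal M W X0 \<sigma> r f \<phi> u m \<longleftrightarrow>
     (\<forall>x. value_fun M W X0 \<sigma> r f \<phi> x m = cost M W \<sigma> r f \<phi> x u m)"

text \<open>
  The strategy built from a function \<open>V\<close>. The defining equation \<open>\<M>V - V = 0\<close> of the action region
  is written as an equality, because subtraction on \<open>ennreal\<close> truncates.
\<close>

definition is_intervention_strategy :: "(real \<Rightarrow> real) \<Rightarrow> (real \<Rightarrow> ennreal) \<Rightarrow> control \<Rightarrow> bool" where
  "is_intervention_strategy \<phi> V u \<longleftrightarrow>
     fst u = {x. intervention_op \<phi> V x = V x} \<and>
     (\<forall>x. is_arg_min (\<lambda>\<delta>. V (x + \<delta>) + ennreal (\<phi> \<delta>)) (\<lambda>_. True) (snd u x))"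

text \<open>
  Two pairs \<open>(A, \<xi>)\<close> describe the same strategy (the same interventions \<open>(\<tau>\<^sub>n, \<xi>\<^sub>n)\<close>) if they have
  the same action region and agree on it: the values of \<open>\<xi>\<close> outside \<open>A\<close> are never used.
\<close>

definition same_strategy :: "control \<Rightarrow> control \<Rightarrow> bool" where
  "same_strategy u v \<longleftrightarrow> fst u = fst v \<and> (\<forall>x\<in>fst u. snd u x = snd v x)"

definition mfg_solution :: "'a measure \<Rightarrow> (real \<Rightarrow> 'a \<Rightarrow> real) \<Rightarrow> ('a \<Rightarrow> real) \<Rightarrow> real \<Rightarrow> real \<Rightarrow>
    (real \<Rightarrow> real \<Rightarrow> real) \<Rightarrow> (real \<Rightarrow> real) \<Rightarrow> control \<Rightarrow> real \<Rightarrow> bool" where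
  "mfg_solution M W X0 \<sigma> r f \<phi> u m \<longleftrightarrow>
     u \<in> admissible M W X0 \<sigma> \<and> optimal M W X0 \<sigma> r f \<phi> u m \<and>
     ereal m = Limsup at_top (\<lambda>t. ereal (\<integral>\<omega>. state u (free_path W \<sigma> X0 \<omega>) t \<partial>M))"

end

theory Submission
  imports Defs
begin

text \<open>
  The mean \<open>m\<close> of the initial distribution is itself an equilibrium mean, together with the optimal
  strategy for it: symmetry keeps the mean of the optimally controlled state at \<open>m\<close> forever. Reflect the whole problem at \<open>m\<close>,
  sending a state \<open>x\<close> to \<open>2 m - x\<close>, an action region \<open>A\<close> to its mirror image, and an impulse
  function \<open>\<xi>\<close> to \<open>x \<mapsto> - \<xi> (2 m - x)\<close>. The controlled dynamics are defined pathwise, so the mirror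
  image of a strategy, applied to the mirror image of a path, produces the mirror image of the state,
  with the same intervention times (\<open>stage_reflect\<close>). The running cost is symmetric around \<open>m\<close> and
  the control cost is even, so the cost does not change either.

  The second ingredient is that the free path \<open>X\<^sub>0\<^sub>- + \<sigma> W\<close> and its mirror image have the same law:
  \<open>W\<close> and \<open>- W\<close> are equal in law, both are independent of \<open>X\<^sub>0\<^sub>-\<close>, and \<open>X\<^sub>0\<^sub>-\<close> is symmetric around \<open>m\<close>
  (\<open>free_path_law_symmetric\<close>). Consequently reflection preserves admissibility and optimality. By the
  uniqueness of the optimal strategy, this strategy is its own mirror image, so the controlled state
  is symmetric around \<open>m\<close> in law at every time and its mean is constantly \<open>m\<close>
  (\<open>mean_state_of_symmetric_strategy\<close>).

  To pass from an equality of laws to an equality of costs, of expectations and of almost sure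
  properties, the intervention times, the states and the costs must be measurable functions of the
  path. This is where most of the work lies. The path space consists of continuous functions only,
  since hitting times are not measurable on the product space of all functions.
\<close>

section \<open>Reflected strategies\<close>

text \<open>The parameter \<open>c\<close> is twice the centre of the reflection.\<close>

definition reflect_control :: "real \<Rightarrow> control \<Rightarrow> control" where
  "reflect_control c u = ({x. c - x \<in> fst u}, \<lambda>x. - snd u (c - x))"

lemma reflect_control_involution [simp]: "reflect_control c (reflect_control c u) = u"
  by (simp add: reflect_control_def)

lemma stage_reflect:
  "stage (reflect_control c u) y n =
    (itime u (\<lambda>t. c - y t) n, - snd (stage u (\<lambda>t. c - y t) n))"
  by (induction n) (simp_all add: itime_def reflect_control_def Let_def algebra_simps)

lemma itime_reflect: "itime (reflect_control c u) y = itime u (\<lambda>t. c - y t)"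
  by (rule ext) (simp add: itime_def[of "reflect_control c u"] stage_reflect)

lemma impulse_reflect: "impulse (reflect_control c u) y n = - impulse u (\<lambda>t. c - y t) n"
  by (simp add: impulse_def itime_reflect stage_reflect) (simp add: reflect_control_def algebra_simps)

lemma state_reflect: "state (reflect_control c u) y t = c - state u (\<lambda>t. c - y t) t"
  by (simp add: state_def itime_reflect impulse_reflect sum_negf)

lemma well_posed_reflect: "well_posed (reflect_control c u) y = well_posed u (\<lambda>t. c - y t)"
  by (simp add: well_posed_def itime_reflect)

lemma path_cost_reflect:
  assumes "\<And>x. f (c - x) m = f x m" "\<And>\<xi>. \<phi> (- \<xi>) = \<phi> \<xi>"
  shows "path_cost r f \<phi> (reflect_control c u) m y = path_cost r f \<phi> u m (\<lambda>t. c - y t)"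
  unfolding path_cost_def state_reflect itime_reflect impulse_reflect assms ..

section \<open>Strategies that agree on the action region\<close>

lemma itime_nonneg: "0 \<le> itime u y n"
  by (cases n) (auto simp: itime_def Let_def intro!: Inf_greatest)

lemma itime_Suc: "itime u y (Suc n) =
    Inf {ereal t | t. 0 \<le> t \<and> itime u y n < ereal t \<and> y t + snd (stage u y (Suc n)) \<in> fst u}"
  by (simp add: itime_def Let_def)

lemma snd_stage_Suc: "snd (stage u y (Suc n)) = snd (stage u y n) + impulse u y n"
  by (simp add: Let_def impulse_def itime_def)

text \<open>The infimum itself need not belong to \<open>S\<close>, for instance if \<open>S\<close> collects the hits strictly after
  a time at which \<open>z\<close> is in \<open>A\<close>, but it is a limit of hitting times.\<close>

lemma Inf_hitting_times_attained:
  fixes z :: "real \<Rightarrow> real"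
  assumes z: "continuous_on {0..} z" and A: "closed A" and S: "S \<subseteq> {t. 0 \<le> t \<and> z t \<in> A}"
    and t: "Inf (ereal ` S) = ereal t"
  shows "z t \<in> A"
proof -
  have cl: "closed ({0..} \<inter> z -` A)"
    using z A by (intro continuous_closed_preimage) auto
  have "t \<in> closure ({0..} \<inter> z -` A)"
    unfolding closure_approachable
  proof (intro allI impI)
    fix e :: real assume "e > 0"
    then have "Inf (ereal ` S) < ereal (t + e)" by (simp add: t)
    then obtain s where s: "s \<in> S" "s < t + e" by (auto simp: Inf_less_iff)
    have "t \<le> s" using Inf_lower[of "ereal s" "ereal ` S"] s t by auto
    then show "\<exists>s\<in>{0..} \<inter> z -` A. dist s t < e"
      using s S by (intro bexI[of _ s]) (auto simp: dist_real_def)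
  qed
  then show ?thesis using closure_closed[OF cl] by auto
qed

text \<open>Intervention times are infima, so this is what ensures that only the values of the impulse
  function on the action region matter. At a time that is a limit of later hits, the state
  \<open>y t + snd (stage u y n)\<close> is in the region because the region is closed.\<close>

lemma pre_intervention_state_in_action_region:
  assumes y: "continuous_on {0..} y" and A: "closed (fst u)"
    and t: "itime u y n = ereal t"
  shows "y t + snd (stage u y n) \<in> fst u"
proof (cases n)
  case 0
  have "Inf (ereal ` {t. 0 \<le> t \<and> y t \<in> fst u}) = ereal t"
    using t 0 by (simp add: itime_def setcompr_eq_image)
  with 0 show ?thesis
    using Inf_hitting_times_attained[of y "fst u" "{t. 0 \<le> t \<and> y t \<in> fst u}" t] y A by auto
next
  case (Suc k)
  define s where "s = snd (stage u y n)"
  have "Inf (ereal ` {t. 0 \<le> t \<and> itime u y k < ereal t \<and> y t + s \<in> fst u}) = ereal t"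
    using t Suc itime_Suc[of u y k] by (simp add: setcompr_eq_image s_def)
  moreover have "continuous_on {0..} (\<lambda>t. y t + s)" using y by (intro continuous_intros)
  ultimately show ?thesis
    using Inf_hitting_times_attained[of "\<lambda>t. y t + s" "fst u"
        "{t. 0 \<le> t \<and> itime u y k < ereal t \<and> y t + s \<in> fst u}" t] A
    by (auto simp: s_def)
qed

text \<open>Once an intervention fails to take place, \<open>stage\<close> continues with an impulse read off at a default
  time, where the two impulse functions may differ; hence the restriction to finite times.\<close>

lemma same_strategy_stage:
  assumes y: "continuous_on {0..} y" and A: "closed (fst u)"
    and same: "same_strategy v u"
  shows "itime v y n = itime u y n \<and>
    (itime u y n < \<infinity> \<longrightarrow> snd (stage v y n) = snd (stage u y n) \<and> impulse v y n = impulse u y n)"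
proof (induction n)
  have imp: "impulse v y n = impulse u y n"
    if eq: "itime v y n = itime u y n" "snd (stage v y n) = snd (stage u y n)"
      and fin: "itime u y n < \<infinity>" for n
  proof -
    obtain t where t: "itime u y n = ereal t"
      using fin itime_nonneg[of u y n] by (cases "itime u y n") auto
    from pre_intervention_state_in_action_region[OF y A t] same show ?thesis
      by (simp add: impulse_def eq t same_strategy_def)
  qed
  case 0
  have "itime v y 0 = itime u y 0" using same by (simp add: itime_def same_strategy_def)
  then show ?case using imp[of 0] by simp
  case (Suc n)
  show ?case
  proof (cases "itime u y n < \<infinity>")
    case True
    then have eq: "snd (stage v y (Suc n)) = snd (stage u y (Suc n))"
      using Suc by (simp only: snd_stage_Suc)
    have "itime v y (Suc n) = itime u y (Suc n)"
      unfolding itime_Suc eq using Suc same by (simp add: same_strategy_def)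
    with eq imp[of "Suc n"] show ?thesis by simp
  next
    case False
    with Suc have "itime v y (Suc n) = \<infinity>" "itime u y (Suc n) = \<infinity>"
      unfolding itime_Suc by (simp_all add: top_ereal_def)
    then show ?thesis by simp
  qed
qed

lemma same_strategy_state:
  assumes "continuous_on {0..} y" "closed (fst u)" "same_strategy v u"
  shows "state v y t = state u y t"
proof -
  have "itime v y n = itime u y n" "itime u y n \<le> ereal t \<Longrightarrow> impulse v y n = impulse u y n" for n
    using same_strategy_stage[OF assms, of n] by auto
  then show ?thesis unfolding state_def by (auto intro!: sum.cong)
qed

section \<open>Measurability on the space of continuous paths\<close>

text \<open>The space of continuous paths on \<open>[0, \<infinity>)\<close> with the \<open>\<sigma>\<close>-algebra generated by the evaluations at
  nonnegative times. Paths are total functions whose values at negative times are arbitrary and not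
  measurable; this is why evaluations below are written at \<open>max 0 t\<close>.\<close>

definition path_space :: "(real \<Rightarrow> real) measure" where
  "path_space = vimage_algebra {y. continuous_on {0..} y} (\<lambda>y. restrict y {0..}) (PiM {0..} (\<lambda>_. borel))"

lemma space_path_space [simp]: "space path_space = {y. continuous_on {0..} y}"
  by (simp add: path_space_def)

lemma measurable_path_restrict:
  "(\<lambda>y. restrict y {0..}) \<in> measurable path_space (PiM {0..} (\<lambda>_. borel))"
  unfolding path_space_def by (rule measurable_vimage_algebra1) (auto simp: space_PiM)

lemma measurable_path_eval: "0 \<le> t \<Longrightarrow> (\<lambda>y. y t) \<in> borel_measurable path_space"
  using measurable_compose[OF measurable_path_restrict measurable_component_singleton[of t]] by simp

text \<open>A continuous path is the pointwise limit of its discretizations to the grids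
  \<open>\<nat> / (n + 1)\<close>, and these use only countably many evaluations.\<close>

lemma measurable_path_eval_joint:
  "(\<lambda>(y, t). y (max 0 t)) \<in> borel_measurable (path_space \<Otimes>\<^sub>M borel)"
proof (rule borel_measurable_LIMSEQ_real)
  fix x assume x: "x \<in> space (path_space \<Otimes>\<^sub>M (borel :: real measure))"
  obtain y t where yt: "x = (y, t)" by (cases x)
  define s where "s = max 0 t"
  have y: "continuous_on {0..} y" using x yt by (simp add: space_pair_measure)
  have "(\<lambda>n. real (nat \<lfloor>real (Suc n) * s\<rfloor>) / real (Suc n)) \<longlonglongrightarrow> s"
  proof (rule tendsto_sandwich)
    show "\<forall>\<^sub>F n in sequentially. s - 1 / real (Suc n) \<le> real (nat \<lfloor>real (Suc n) * s\<rfloor>) / real (Suc n)"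
    proof (intro always_eventually allI)
      fix n
      have "real (Suc n) * s - 1 \<le> real (nat \<lfloor>real (Suc n) * s\<rfloor>)" by linarith
      then have "(real (Suc n) * s - 1) / real (Suc n) \<le> real (nat \<lfloor>real (Suc n) * s\<rfloor>) / real (Suc n)"
        by (rule divide_right_mono) simp
      then show "s - 1 / real (Suc n) \<le> real (nat \<lfloor>real (Suc n) * s\<rfloor>) / real (Suc n)"
        by (simp add: diff_divide_distrib del: of_nat_Suc)
    qed
    show "\<forall>\<^sub>F n in sequentially. real (nat \<lfloor>real (Suc n) * s\<rfloor>) / real (Suc n) \<le> s"
    proof (intro always_eventually allI)
      fix n
      have "0 \<le> real (Suc n) * s" by (simp add: s_def)
      then have "real (nat \<lfloor>real (Suc n) * s\<rfloor>) \<le> real (Suc n) * s" by linarith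
      then show "real (nat \<lfloor>real (Suc n) * s\<rfloor>) / real (Suc n) \<le> s"
        by (simp add: field_simps del: of_nat_Suc)
    qed
    show "(\<lambda>n. s - 1 / real (Suc n)) \<longlonglongrightarrow> s"
      using tendsto_diff[OF tendsto_const[of s] LIMSEQ_inverse_real_of_nat]
      by (simp add: inverse_eq_divide)
  qed simp
  then have "(\<lambda>n. y (real (nat \<lfloor>real (Suc n) * s\<rfloor>) / real (Suc n))) \<longlonglongrightarrow> y s"
    by (intro continuous_on_tendsto_compose[OF y]) (auto simp: s_def)
  then show "(\<lambda>n. (\<lambda>(y, t). y (real (nat \<lfloor>real (Suc n) * max 0 t\<rfloor>) / real (Suc n))) x)
      \<longlonglongrightarrow> (\<lambda>(y, t). y (max 0 t)) x"
    by (simp add: yt s_def)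
next
  fix n
  have [measurable]: "(\<lambda>x. fst x (real k / real (Suc n))) \<in> borel_measurable (path_space \<Otimes>\<^sub>M (borel :: real measure))" for k
    by (rule measurable_compose[OF measurable_fst measurable_path_eval]) simp
  have "(\<lambda>x. fst x (real (nat \<lfloor>real (Suc n) * max 0 (snd x)\<rfloor>) / real (Suc n)))
      \<in> borel_measurable (path_space \<Otimes>\<^sub>M borel)"
    by (rule measurable_compose_countable[where g="\<lambda>x. nat \<lfloor>real (Suc n) * max 0 (snd x)\<rfloor>"
          and f="\<lambda>k x. fst x (real k / real (Suc n))"]) measurable
  then show "(\<lambda>(y, t). y (real (nat \<lfloor>real (Suc n) * max 0 t\<rfloor>) / real (Suc n)))
      \<in> borel_measurable (path_space \<Otimes>\<^sub>M borel)"
    by (simp add: case_prod_beta')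
qed

text \<open>By compactness, a continuous path hits a closed set as soon as it comes arbitrarily close to it.
  This turns hitting into an event described by countably many evaluations.\<close>

lemma hits_iff_rational_infdist_small:
  fixes z :: "real \<Rightarrow> real"
  assumes z: "continuous_on {p..q} z" and A: "closed A" "A \<noteq> {}" and pq: "p < q"
  shows "(\<exists>t\<in>{p..q}. z t \<in> A) \<longleftrightarrow>
    (\<forall>k::nat. \<exists>t::rat. p \<le> of_rat t \<and> of_rat t \<le> q \<and> infdist (z (of_rat t)) A < 1 / Suc k)"
proof
  have d: "continuous_on {p..q} (\<lambda>t. infdist (z t) A)"
    using z by (intro continuous_intros)
  { assume "\<exists>t\<in>{p..q}. z t \<in> A"
    then obtain t where t: "t \<in> {p..q}" "infdist (z t) A = 0" by auto
    show "\<forall>k::nat. \<exists>t::rat. p \<le> of_rat t \<and> of_rat t \<le> q \<and> infdist (z (of_rat t)) A < 1 / Suc k"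
    proof
      fix k :: nat
      obtain e where e: "e > 0" "\<And>s. s \<in> {p..q} \<Longrightarrow> dist s t < e \<Longrightarrow> dist (infdist (z s) A) (infdist (z t) A) < 1 / Suc k"
        using d t unfolding continuous_on_iff by (metis zero_less_divide_1_iff of_nat_0_less_iff zero_less_Suc)
      have "max p (t - e) < min q (t + e)" using e pq t by auto
      then obtain s :: rat where "max p (t - e) < of_rat s" "of_rat s < min q (t + e)"
        using of_rat_dense by blast
      then show "\<exists>t::rat. p \<le> of_rat t \<and> of_rat t \<le> q \<and> infdist (z (of_rat t)) A < 1 / Suc k"
        using e(2)[of "of_rat s"] t by (intro exI[of _ s]) (auto simp: dist_real_def abs_less_iff)
    qed }
  { assume *: "\<forall>k::nat. \<exists>t::rat. p \<le> of_rat t \<and> of_rat t \<le> q \<and> infdist (z (of_rat t)) A < 1 / Suc k"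
    obtain t where t: "t \<in> {p..q}" "\<And>s. s \<in> {p..q} \<Longrightarrow> infdist (z t) A \<le> infdist (z s) A"
      using continuous_attains_inf[OF compact_Icc _ d] pq by auto
    have "infdist (z t) A \<le> 0"
    proof (rule ccontr)
      assume "\<not> ?thesis"
      then obtain k where "1 / real (Suc k) < infdist (z t) A"
        using nat_approx_posE[of "infdist (z t) A"] by auto
      moreover from * obtain s :: rat where "of_rat s \<in> {p..q}" "infdist (z (of_rat s)) A < 1 / Suc k"
        by (metis atLeastAtMost_iff)
      ultimately show False using t(2)[of "of_rat s"] by linarith
    qed
    then have "z t \<in> A" using in_closed_iff_infdist_zero[OF A] infdist_nonneg[of "z t" A] by simp
    with t show "\<exists>t\<in>{p..q}. z t \<in> A" by auto }
qed

text \<open>The infimum is below \<open>c\<close> iff there is a hit in the open interval from \<open>\<tau> y\<close> to \<open>c\<close>, hence in one of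
  the countably many compact intervals \<open>[p, q]\<close> inside it with rational endpoints and \<open>p \<ge> 0\<close>, to
  which \<open>hits_iff_rational_infdist_small\<close> applies. The strict bound \<open>\<tau> y\<close> may be negative: with
  \<open>\<tau> = -\<infinity>\<close> this covers the first intervention, which may take place at time 0.\<close>

lemma measurable_hitting_time:
  assumes A: "closed A" and [measurable]: "\<tau> \<in> borel_measurable path_space" "s \<in> borel_measurable path_space"
  shows "(\<lambda>y. Inf {ereal t | t. 0 \<le> t \<and> \<tau> y < ereal t \<and> y t + s y \<in> A}) \<in> borel_measurable path_space"
proof (cases "A = {}")
  case False
  show ?thesis
  proof (rule borel_measurableI_less)
    fix c :: ereal
    define P where "P p q y \<longleftrightarrow> (0::real) \<le> of_rat p \<and> p < q \<and> \<tau> y < ereal (of_rat p) \<and> ereal (of_rat q) < c \<and>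
      (\<forall>k::nat. \<exists>t::rat. real_of_rat p \<le> of_rat t \<and> of_rat t \<le> real_of_rat q \<and>
         infdist (y (max 0 (of_rat t)) + s y) A < 1 / Suc k)" for p q :: rat and y
    have eval: "(\<lambda>y. y (max 0 t)) \<in> borel_measurable path_space" for t
      by (rule measurable_path_eval) simp
    have [measurable]: "(\<lambda>y. infdist (y (max 0 t) + s y) A) \<in> borel_measurable path_space" for t
      by (rule measurable_compose[OF borel_measurable_add[OF eval assms(3)]
            borel_measurable_continuous_onI[OF continuous_on_infdist[OF continuous_on_id]]])
    have "{y \<in> space path_space. Inf {ereal t | t. 0 \<le> t \<and> \<tau> y < ereal t \<and> y t + s y \<in> A} < c} =
      {y \<in> space path_space. \<exists>p q. P p q y}"
    proof (intro Collect_cong conj_cong refl)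
      fix y assume "y \<in> space path_space"
      then have y: "continuous_on {0..} y" by simp
      have P: "P p q y \<longleftrightarrow> (0::real) \<le> of_rat p \<and> p < q \<and> \<tau> y < ereal (of_rat p) \<and> ereal (of_rat q) < c \<and>
          (\<exists>t\<in>{of_rat p..of_rat q}. y t + s y \<in> A)" for p q
      proof (cases "(0::real) \<le> of_rat p \<and> p < q")
        case True
        then have *: "max 0 (of_rat t) = (of_rat t :: real)" if "real_of_rat p \<le> of_rat t" for t
          using that by linarith
        have "continuous_on {of_rat p..of_rat q} (\<lambda>t. y t + s y)"
          using True by (intro continuous_intros continuous_on_subset[OF y]) auto
        from hits_iff_rational_infdist_small[OF this A False] True * show ?thesis
          unfolding P_def by (auto simp: of_rat_less) metis+
      qed (auto simp: P_def)
      show "Inf {ereal t | t. 0 \<le> t \<and> \<tau> y < ereal t \<and> y t + s y \<in> A} < c \<longleftrightarrow> (\<exists>p q. P p q y)"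
      proof
        assume "Inf {ereal t | t. 0 \<le> t \<and> \<tau> y < ereal t \<and> y t + s y \<in> A} < c"
        then obtain t where t: "0 \<le> t" "\<tau> y < ereal t" "y t + s y \<in> A" "ereal t < c"
          by (auto simp: Inf_less_iff)
        obtain q' where q': "t < q'" "ereal q' < c"
          using ereal_dense2[OF t(4)] by auto
        obtain q where q: "t < of_rat q" "of_rat q < q'" using of_rat_dense[OF q'(1)] by auto
        obtain p :: rat where p: "\<tau> y < ereal (of_rat p)" "0 \<le> real_of_rat p" "of_rat p \<le> t"
        proof (cases "t = 0")
          case True
          then show thesis using that[of 0] t(2) by simp
        next
          case False
          then have "max 0 (\<tau> y) < ereal t" using t by (auto simp: max_def)
          then obtain p' where p': "max 0 (\<tau> y) < ereal p'" "p' < t"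
            using ereal_dense2 by (metis ereal_less_eq(3) less_ereal.simps(1))
          obtain p where p: "p' < of_rat p" "of_rat p < t" using of_rat_dense[OF p'(2)] by auto
          have "0 < p'" "\<tau> y < ereal p'" using p'(1) by (auto simp: zero_ereal_def)
          then have "\<tau> y < ereal (of_rat p)" "0 < real_of_rat p" using p(1)
            by (auto intro: less_trans[of _ "ereal p'"] simp del: zero_less_of_rat_iff)
          then show thesis using that[of p] p(2) by simp
        qed
        have "ereal (of_rat q) < c" using q(2) q'(2) by (auto intro: less_trans[of _ "ereal q'"])
        moreover have "p < q" using p(3) q(1) by (metis le_less_trans of_rat_less)
        ultimately have "P p q y" unfolding P using t(3) p q(1) by (auto intro!: bexI[of _ t])
        then show "\<exists>p q. P p q y" by blast
      next
        assume "\<exists>p q. P p q y"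
        then obtain t where "0 \<le> t" "\<tau> y < ereal t" "y t + s y \<in> A" "ereal t < c"
        proof (elim exE)
          fix p q assume "P p q y"
          then obtain t where t: "(0::real) \<le> of_rat p" "\<tau> y < ereal (of_rat p)" "ereal (of_rat q) < c"
              "of_rat p \<le> t" "t \<le> of_rat q" "y t + s y \<in> A" unfolding P by auto
          have "\<tau> y < ereal t" using t(2,4) by (auto intro: less_le_trans[of _ "ereal (of_rat p)"])
          moreover have "ereal t < c" using t(3,5) by (auto intro: le_less_trans[of _ "ereal (of_rat q)"])
          ultimately show thesis using that[of t] t by auto
        qed
        then show "Inf {ereal t | t. 0 \<le> t \<and> \<tau> y < ereal t \<and> y t + s y \<in> A} < c"
          by (auto simp: Inf_less_iff)
      qed
    qed
    moreover have "{y \<in> space path_space. \<exists>p q. P p q y} \<in> sets path_space"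
    proof -
      have [measurable]: "Measurable.pred path_space (P p q)" for p q
        unfolding P_def by measurable
      show ?thesis by measurable
    qed
    ultimately show "{y \<in> space path_space. Inf {ereal t | t. 0 \<le> t \<and> \<tau> y < ereal t \<and> y t + s y \<in> A} < c} \<in> sets path_space"
      by simp
  qed
qed simp

lemma measurable_stage:
  assumes u: "closed (fst u)" and [measurable]: "snd u \<in> borel_measurable borel"
  shows "(\<lambda>y. itime u y n) \<in> borel_measurable path_space \<and>
    (\<lambda>y. snd (stage u y n)) \<in> borel_measurable path_space \<and>
    (\<lambda>y. impulse u y n) \<in> borel_measurable path_space"
proof (induction n)
  have imp: "(\<lambda>y. impulse u y n) \<in> borel_measurable path_space"
    if [measurable]: "(\<lambda>y. itime u y n) \<in> borel_measurable path_space"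
        "(\<lambda>y. snd (stage u y n)) \<in> borel_measurable path_space" for n
  proof -
    have "(\<lambda>y. (\<lambda>(y, t). y (max 0 t)) (y, real_of_ereal (itime u y n))) \<in> borel_measurable path_space"
      by (rule measurable_compose[OF _ measurable_path_eval_joint]) measurable
    then have [measurable]: "(\<lambda>y. y (real_of_ereal (itime u y n))) \<in> borel_measurable path_space"
      using itime_nonneg[of u _ n] by (simp add: max_absorb2 real_of_ereal_pos)
    show ?thesis unfolding impulse_def by measurable
  qed
  case 0
  have "(\<lambda>y. itime u y 0) \<in> borel_measurable path_space"
    using measurable_hitting_time[OF u, of "\<lambda>_. -\<infinity>" "\<lambda>_. 0"] by (simp add: itime_def)
  then show ?case using imp[of 0] by simp
  case (Suc n)
  then have "(\<lambda>y. snd (stage u y (Suc n))) \<in> borel_measurable path_space"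
    unfolding snd_stage_Suc by (intro borel_measurable_add) auto
  moreover from this Suc have "(\<lambda>y. itime u y (Suc n)) \<in> borel_measurable path_space"
    unfolding itime_Suc by (intro measurable_hitting_time u) auto
  ultimately show ?case using imp[of "Suc n"] by simp
qed

context
  fixes u :: control
  assumes u: "closed (fst u)" "snd u \<in> borel_measurable borel"
begin

lemma measurable_itime: "(\<lambda>y. itime u y n) \<in> borel_measurable path_space"
  and measurable_impulse: "(\<lambda>y. impulse u y n) \<in> borel_measurable path_space"
  using measurable_stage[OF u] by auto

lemma well_posed_sets: "{y \<in> space path_space. well_posed u y} \<in> sets path_space"
proof -
  note [measurable] = measurable_itime
  have "well_posed u y \<longleftrightarrow> (\<forall>n. itime u y n < \<infinity> \<longrightarrow> itime u y n < itime u y (Suc n)) \<and>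
    (\<forall>k::nat. \<exists>n0. \<forall>n\<ge>n0. ereal (real k) < itime u y n)" for y
  proof -
    have "itime u y \<longlonglongrightarrow> \<infinity> \<longleftrightarrow> (\<forall>k::nat. \<exists>n0. \<forall>n\<ge>n0. ereal (real k) < itime u y n)"
      unfolding tendsto_PInfty eventually_sequentially
      by (meson le_less_trans ereal_less_eq(3) real_arch_simple)
    then show ?thesis by (simp add: well_posed_def)
  qed
  then have "{y \<in> space path_space. well_posed u y} =
    {y \<in> space path_space. (\<forall>n. itime u y n < \<infinity> \<longrightarrow> itime u y n < itime u y (Suc n)) \<and>
      (\<forall>k::nat. \<exists>n0. \<forall>n\<ge>n0. ereal (real k) < itime u y n)}" by blast
  also have "\<dots> \<in> sets path_space" by measurable
  finally show ?thesis .
qed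

text \<open>The index set of the accumulated impulses depends on the path, so their sum is rewritten as a
  series over all interventions. If the index set is infinite, the sum is 0 by convention while the
  series may be anything; this is why the two cases are distinguished.\<close>

lemma measurable_state_joint: "(\<lambda>(y, t). state u y (max 0 t)) \<in> borel_measurable (path_space \<Otimes>\<^sub>M borel)"
proof -
  note [measurable] = measurable_itime measurable_impulse
  have sum_eq: "(\<Sum>n | itime u y n \<le> ereal t. impulse u y n) =
    (if \<exists>k. \<forall>n\<ge>k. \<not> itime u y n \<le> ereal t
     then suminf (\<lambda>n. if itime u y n \<le> ereal t then impulse u y n else 0) else 0)" for y t
  proof (cases "finite {n. itime u y n \<le> ereal t}")
    case True
    then have "suminf (\<lambda>n. if itime u y n \<le> ereal t then impulse u y n else 0) =
      (\<Sum>n | itime u y n \<le> ereal t. if itime u y n \<le> ereal t then impulse u y n else 0)"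
      by (intro suminf_finite) auto
    moreover have "\<exists>k. \<forall>n\<ge>k. \<not> itime u y n \<le> ereal t"
      using True unfolding finite_nat_set_iff_bounded by (meson mem_Collect_eq not_le)
    ultimately show ?thesis by simp
  next
    case False
    then have "\<not> (\<exists>k. \<forall>n\<ge>k. \<not> itime u y n \<le> ereal t)"
      unfolding finite_nat_set_iff_bounded by (auto simp: not_le) (meson not_le)
    then show ?thesis unfolding sum.infinite[OF False] by (rule if_not_P[symmetric])
  qed
  show ?thesis
    unfolding state_def sum_eq case_prod_beta'
    using measurable_path_eval_joint[unfolded case_prod_beta'] by measurable
qed

lemma measurable_state: "0 \<le> t \<Longrightarrow> (\<lambda>y. state u y t) \<in> borel_measurable path_space"
  using measurable_compose[OF measurable_Pair[OF measurable_ident measurable_const] measurable_state_joint, of t]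
  by simp

lemma measurable_path_cost:
  assumes [measurable]: "(\<lambda>x. f x m) \<in> borel_measurable borel" "\<phi> \<in> borel_measurable borel"
  shows "path_cost r f \<phi> u m \<in> borel_measurable path_space"
proof -
  note [measurable] = measurable_itime measurable_impulse
  have [measurable]: "(\<lambda>x. state u (fst x) (max 0 (snd x))) \<in> borel_measurable (path_space \<Otimes>\<^sub>M lborel)"
    using measurable_state_joint by (simp add: case_prod_beta')
  have "(\<lambda>y. \<integral>\<^sup>+ t. ennreal (exp (- r * t) * f (state u y (max 0 t)) m) * indicator {0..} t \<partial>lborel)
      \<in> borel_measurable path_space"
    by (rule lborel.borel_measurable_nn_integral) measurable
  moreover have "(\<integral>\<^sup>+ t\<in>{0..}. ennreal (exp (- r * t) * f (state u y t) m) \<partial>lborel) =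
      (\<integral>\<^sup>+ t. ennreal (exp (- r * t) * f (state u y (max 0 t)) m) * indicator {0..} t \<partial>lborel)" for y
    by (intro nn_integral_cong) (auto simp: indicator_def)
  moreover have "(\<lambda>y. if itime u y n = \<infinity> then 0
      else ennreal (exp (- r * real_of_ereal (itime u y n)) * \<phi> (impulse u y n))) \<in> borel_measurable path_space" for n
    by measurable
  ultimately show ?thesis
    unfolding path_cost_def by (simp only:) (intro borel_measurable_add borel_measurable_suminf_order)
qed

end

section \<open>Reflection invariance of the law of the free path\<close>

definition increment_law :: "real \<Rightarrow> real \<Rightarrow> real measure" where
  "increment_law s t = density lborel (normal_density 0 (sqrt (t - s)))"

lemma increment_law_symmetric:
  fixes g :: "real \<Rightarrow> ennreal"
  assumes [measurable]: "g \<in> borel_measurable borel"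
  shows "(\<integral>\<^sup>+ d. g (- d) \<partial>increment_law s t) = (\<integral>\<^sup>+ d. g d \<partial>increment_law s t)"
  unfolding increment_law_def
  by (subst (1 2) nn_integral_density, measurable)
    (subst (2) nn_integral_real_affine[where c="-1" and t=0], simp_all add: normal_density_def)

context adapted_brownian_motion
begin

lemma F_borel_measurable_mono: "0 \<le> s \<Longrightarrow> s \<le> t \<Longrightarrow> X \<in> measurable (F s) N \<Longrightarrow> X \<in> measurable (F t) N"
  using measurable_from_subalg[OF F_mono] .

lemma F_measurable: "0 \<le> t \<Longrightarrow> X \<in> measurable (F t) N \<Longrightarrow> X \<in> measurable M N"
  using measurable_from_subalg[OF subalgebra_F] .

lemma W_measurable [measurable]: "0 \<le> t \<Longrightarrow> W t \<in> borel_measurable M"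
  using F_measurable[OF _ adapted] .

text \<open>The Markov property, in the form of Fubini's theorem: an increment is independent of the past, so
  the past and the increment together have a product law.\<close>

lemma integrate_out_increment:
  fixes g :: "real \<Rightarrow> ennreal"
  assumes st: "0 \<le> s" "s < t"
    and Z: "Z \<in> borel_measurable (F s)" and U: "U \<in> borel_measurable (F s)" and g [measurable]: "g \<in> borel_measurable borel"
  shows "(\<integral>\<^sup>+ \<omega>. Z \<omega> * g (U \<omega> + c * (W t \<omega> - W s \<omega>)) \<partial>M) =
    (\<integral>\<^sup>+ \<omega>. Z \<omega> * (\<integral>\<^sup>+ d. g (U \<omega> + c * d) \<partial>increment_law s t) \<partial>M)"
proof -
  define D where "D \<omega> = W t \<omega> - W s \<omega>" for \<omega>
  have sub: "subalgebra M (F s)" using subalgebra_F st by simp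
  then have sp: "space (F s) = space M" by (simp add: subalgebra_def)
  have id: "(\<lambda>\<omega>. \<omega>) \<in> measurable M (F s)" using F_measurable[OF st(1) measurable_ident_sets[OF refl]] .
  have D [measurable]: "D \<in> borel_measurable M" unfolding D_def using st by (intro borel_measurable_diff W_measurable) auto
  interpret D: prob_space "distr M borel D" by (rule prob_space_distr) simp
  interpret past: prob_space "distr M (F s) (\<lambda>\<omega>. \<omega>)" by (rule prob_space_distr[OF id])
  have pair: "distr M (F s) (\<lambda>\<omega>. \<omega>) \<Otimes>\<^sub>M distr M borel D = distr M (F s \<Otimes>\<^sub>M borel) (\<lambda>\<omega>. (\<omega>, D \<omega>))"
  proof (rule pair_measure_eqI)
    fix A B assume "A \<in> sets (distr M (F s) (\<lambda>\<omega>. \<omega>))" "B \<in> sets (distr M borel D)"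
    then have A: "A \<in> sets (F s)" and B: "B \<in> sets borel" by simp_all
    have past: "A \<inter> space M = A" using sets.sets_into_space[OF A] sp by auto
    have B': "D -` B \<inter> space M \<in> sets (vimage_algebra (space M) (\<lambda>\<omega>. W t \<omega> - W s \<omega>) borel)"
      using in_vimage_algebra[OF B] by (simp only: D_def[abs_def])
    have "prob (A \<inter> (D -` B \<inter> space M)) = prob A * prob (D -` B \<inter> space M)"
      by (rule indep_setD[OF independent_increments[OF st] A B'])
    moreover have "(\<lambda>\<omega>. (\<omega>, D \<omega>)) -` (A \<times> B) \<inter> space M = A \<inter> (D -` B \<inter> space M)"
      using past by blast
    ultimately show "emeasure (distr M (F s) (\<lambda>\<omega>. \<omega>)) A * emeasure (distr M borel D) B =
        emeasure (distr M (F s \<Otimes>\<^sub>M borel) (\<lambda>\<omega>. (\<omega>, D \<omega>))) (A \<times> B)"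
      using A B by (simp add: emeasure_distr id measurable_Pair[OF id D] past emeasure_eq_measure ennreal_mult)
  qed (auto intro!: prob_space_imp_sigma_finite D.prob_space_axioms past.prob_space_axioms sets_pair_measure_cong)
  have law: "distr M borel D = increment_law s t"
  proof -
    have "distr M borel D = distr M lborel D" by (rule distr_cong) auto
    also have "\<dots> = increment_law s t"
      using distributed_distr_eq_density[OF gaussian_increments[OF st]] by (simp add: increment_law_def D_def[abs_def])
    finally show ?thesis .
  qed
  have [measurable]: "Z \<in> borel_measurable (F s)" "U \<in> borel_measurable (F s)" by fact+
  have "(\<integral>\<^sup>+ \<omega>. Z \<omega> * g (U \<omega> + c * D \<omega>) \<partial>M) =
      (\<integral>\<^sup>+ x. Z (fst x) * g (U (fst x) + c * snd x) \<partial>distr M (F s \<Otimes>\<^sub>M borel) (\<lambda>\<omega>. (\<omega>, D \<omega>)))"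
    by (subst nn_integral_distr) (use id in measurable)
  also have "\<dots> = (\<integral>\<^sup>+ \<omega>. (\<integral>\<^sup>+ d. Z \<omega> * g (U \<omega> + c * d) \<partial>distr M borel D) \<partial>distr M (F s) (\<lambda>\<omega>. \<omega>))"
    unfolding pair[symmetric] by (subst D.nn_integral_fst[symmetric]) simp_all
  also have "\<dots> = (\<integral>\<^sup>+ \<omega>. (\<integral>\<^sup>+ d. Z \<omega> * g (U \<omega> + c * d) \<partial>distr M borel D) \<partial>M)"
    by (rule nn_integral_distr[OF id]) measurable
  also have "\<dots> = (\<integral>\<^sup>+ \<omega>. Z \<omega> * (\<integral>\<^sup>+ d. g (U \<omega> + c * d) \<partial>distr M borel D) \<partial>M)"
    by (simp add: nn_integral_cmult)
  finally show ?thesis by (simp add: law D_def)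
qed

lemma free_path_start:
  assumes "X \<in> borel_measurable (F 0)" "g \<in> borel_measurable borel"
  shows "(\<integral>\<^sup>+ \<omega>. g (free_path W c X \<omega> 0) \<partial>M) = (\<integral>\<^sup>+ x. g x \<partial>distr M borel X)"
proof -
  have X: "X \<in> borel_measurable M" using F_measurable assms(1) by blast
  have "(\<integral>\<^sup>+ \<omega>. g (free_path W c X \<omega> 0) \<partial>M) = (\<integral>\<^sup>+ \<omega>. g (X \<omega>) \<partial>M)"
    using start by (intro nn_integral_cong_AE) (auto simp: free_path_def)
  then show ?thesis using X assms(2) by (simp add: nn_integral_distr)
qed

text \<open>One step backwards in time: after integrating out the last increment, the factor at the last time
  becomes an additional factor at the time before it.\<close>

lemma free_path_last_time:
  fixes g :: "real \<Rightarrow> real \<Rightarrow> ennreal"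
  assumes X: "X \<in> borel_measurable (F 0)" and g: "\<And>t. g t \<in> borel_measurable borel"
    and J: "finite J" "J \<noteq> {}" "J \<subseteq> {0..}" "Max J < t"
  shows "(\<integral>\<^sup>+ \<omega>. (\<Prod>i\<in>insert t J. g i (free_path W c X \<omega> i)) \<partial>M) =
    (\<integral>\<^sup>+ \<omega>. (\<Prod>i\<in>J. (g(Max J := \<lambda>x. g (Max J) x * (\<integral>\<^sup>+ d. g t (x + c * d) \<partial>increment_law (Max J) t))) i
        (free_path W c X \<omega> i)) \<partial>M)"
proof -
  define s where "s = Max J"
  have "s \<in> J" using Max_in[OF J(1,2)] by (simp add: s_def)
  moreover from this have "0 \<le> s" using J(3) by auto
  moreover have "s < t" using J(4) by (simp only: s_def)
  moreover have "i \<le> s" if "i \<in> J" for i unfolding s_def by (rule Max_ge[OF J(1) that])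
  ultimately have s: "s \<in> J" "0 \<le> s" "s < t" "\<And>i. i \<in> J \<Longrightarrow> i \<le> s" by blast+
  let ?Y = "free_path W c X"
  have Y: "(\<lambda>\<omega>. ?Y \<omega> i) \<in> borel_measurable (F s)" if "0 \<le> i" "i \<le> s" for i
    unfolding free_path_def
    by (intro borel_measurable_add borel_measurable_times borel_measurable_const
        F_borel_measurable_mono[OF order_refl s(2) X] F_borel_measurable_mono[OF that adapted[OF that(1)]])
  have "t \<notin> J" using s(3) s(4)[of t] by (meson not_le)
  have "(\<integral>\<^sup>+ \<omega>. (\<Prod>i\<in>insert t J. g i (?Y \<omega> i)) \<partial>M) =
      (\<integral>\<^sup>+ \<omega>. (\<Prod>i\<in>J. g i (?Y \<omega> i)) * g t (?Y \<omega> s + c * (W t \<omega> - W s \<omega>)) \<partial>M)"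
  proof (rule nn_integral_cong)
    fix \<omega>
    have "?Y \<omega> t = ?Y \<omega> s + c * (W t \<omega> - W s \<omega>)"
      by (simp add: free_path_def algebra_simps)
    then show "(\<Prod>i\<in>insert t J. g i (?Y \<omega> i)) = (\<Prod>i\<in>J. g i (?Y \<omega> i)) * g t (?Y \<omega> s + c * (W t \<omega> - W s \<omega>))"
      by (simp only: prod.insert[OF J(1) \<open>t \<notin> J\<close>] mult.commute)
  qed
  also have "\<dots> = (\<integral>\<^sup>+ \<omega>. (\<Prod>i\<in>J. g i (?Y \<omega> i)) * (\<integral>\<^sup>+ d. g t (?Y \<omega> s + c * d) \<partial>increment_law s t) \<partial>M)"
  proof (rule integrate_out_increment[OF s(2,3) _ _ g])
    show "(\<lambda>\<omega>. \<Prod>i\<in>J. g i (?Y \<omega> i)) \<in> borel_measurable (F s)"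
    proof (rule borel_measurable_prod_ennreal)
      fix i assume "i \<in> J"
      then have "0 \<le> i" "i \<le> s" using J(3) s(4) by auto
      then show "(\<lambda>\<omega>. g i (?Y \<omega> i)) \<in> borel_measurable (F s)" by (rule measurable_compose[OF Y g])
    qed
    show "(\<lambda>\<omega>. ?Y \<omega> s) \<in> borel_measurable (F s)" using s(2) by (rule Y) simp
  qed
  also have "\<dots> = (\<integral>\<^sup>+ \<omega>. (\<Prod>i\<in>J. (g(s := \<lambda>x. g s x * (\<integral>\<^sup>+ d. g t (x + c * d) \<partial>increment_law s t))) i (?Y \<omega> i)) \<partial>M)"
  proof (rule nn_integral_cong)
    fix \<omega>
    define h where "h x = (\<integral>\<^sup>+ d. g t (x + c * d) \<partial>increment_law s t)" for x
    have "(\<Prod>i\<in>J. (g(s := \<lambda>x. g s x * h x)) i (?Y \<omega> i)) =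
        g s (?Y \<omega> s) * h (?Y \<omega> s) * (\<Prod>i\<in>J - {s}. g i (?Y \<omega> i))"
      unfolding prod.remove[OF J(1) s(1)] by (intro arg_cong2[where f="(*)"] prod.cong) simp_all
    also have "\<dots> = (\<Prod>i\<in>J. g i (?Y \<omega> i)) * h (?Y \<omega> s)"
      unfolding prod.remove[OF J(1) s(1)] by (simp only: ac_simps)
    finally show "(\<Prod>i\<in>J. g i (?Y \<omega> i)) * (\<integral>\<^sup>+ d. g t (?Y \<omega> s + c * d) \<partial>increment_law s t) =
        (\<Prod>i\<in>J. (g(s := \<lambda>x. g s x * (\<integral>\<^sup>+ d. g t (x + c * d) \<partial>increment_law s t))) i (?Y \<omega> i))"
      by (simp only: h_def)
  qed
  finally show ?thesis unfolding s_def .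
qed

text \<open>Induction on the number of times, removing the last one: the kernels integrated out in
  \<open>free_path_last_time\<close> are the same for \<open>c\<close> and \<open>- c\<close>, because the increments are symmetric. Time 0
  is always included, so that a previous time exists and the initial law enters only in the base
  case.\<close>

lemma free_path_finite_dim:
  fixes g :: "real \<Rightarrow> real \<Rightarrow> ennreal"
  assumes X: "X \<in> borel_measurable (F 0)" "X' \<in> borel_measurable (F 0)" and eq: "distr M borel X = distr M borel X'"
    and J: "finite J" "J \<subseteq> {0<..}" and g: "\<And>t. g t \<in> borel_measurable borel"
  shows "(\<integral>\<^sup>+ \<omega>. (\<Prod>i\<in>insert 0 J. g i (free_path W c X \<omega> i)) \<partial>M) =
    (\<integral>\<^sup>+ \<omega>. (\<Prod>i\<in>insert 0 J. g i (free_path W (- c) X' \<omega> i)) \<partial>M)"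
  using J g
proof (induction J arbitrary: g rule: finite_linorder_max_induct)
  case empty
  then show ?case using free_path_start[OF X(1)] free_path_start[OF X(2)] eq by simp
next
  case (insert t J)
  define s where "s = Max (insert 0 J)"
  have J: "finite (insert 0 J)" "insert 0 J \<noteq> {}" "insert 0 J \<subseteq> {0..}" "Max (insert 0 J) < t"
    using insert by auto
  note [measurable] = insert.prems(2)
  define h where "h x = (\<integral>\<^sup>+ d. g t (x + c * d) \<partial>increment_law s t)" for x
  have h': "(\<integral>\<^sup>+ d. g t (x + - c * d) \<partial>increment_law s t) = h x" for x
    using increment_law_symmetric[of "\<lambda>d. g t (x + c * d)"] by (simp add: h_def)
  have "sigma_finite_measure (increment_law s t)"
    unfolding increment_law_def using J(4) prob_space_normal_density[of "sqrt (t - s)" 0]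
    by (intro prob_space_imp_sigma_finite) (auto simp: s_def)
  then interpret sigma_finite_measure "increment_law s t" .
  have [simp]: "sets (increment_law s t) = sets borel" by (simp add: increment_law_def)
  have [measurable]: "h \<in> borel_measurable borel" unfolding h_def
    by (rule borel_measurable_nn_integral, subst measurable_cong_sets[OF sets_pair_measure_cong[OF refl] refl], simp, measurable)
  let ?g = "g(s := \<lambda>x. g s x * h x)"
  have "(\<integral>\<^sup>+ \<omega>. (\<Prod>i\<in>insert t (insert 0 J). g i (free_path W c X \<omega> i)) \<partial>M) =
      (\<integral>\<^sup>+ \<omega>. (\<Prod>i\<in>insert 0 J. ?g i (free_path W c X \<omega> i)) \<partial>M)"
    unfolding h_def s_def by (rule free_path_last_time[OF X(1) insert.prems(2) J])
  also have "\<dots> = (\<integral>\<^sup>+ \<omega>. (\<Prod>i\<in>insert 0 J. ?g i (free_path W (- c) X' \<omega> i)) \<partial>M)"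
  proof (rule insert.IH)
    show "J \<subseteq> {0<..}" using insert.prems(1) by blast
    show "?g i \<in> borel_measurable borel" for i by (cases "i = s") auto
  qed
  also have "\<dots> = (\<integral>\<^sup>+ \<omega>. (\<Prod>i\<in>insert t (insert 0 J). g i (free_path W (- c) X' \<omega> i)) \<partial>M)"
    unfolding h'[symmetric] unfolding s_def by (rule free_path_last_time[OF X(2) insert.prems(2) J, symmetric])
  finally show ?case unfolding insert_commute[of 0 t J] .
qed

lemma measurable_free_path:
  assumes X: "X \<in> borel_measurable (F 0)"
  shows "free_path W c X \<in> measurable M path_space"
  unfolding path_space_def
proof (rule measurable_vimage_algebra2)
  show "free_path W c X \<in> space M \<rightarrow> {y. continuous_on {0..} y}"
    unfolding free_path_def by (auto intro!: continuous_intros continuous_paths)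
  have [measurable]: "X \<in> borel_measurable M" using F_measurable X by blast
  show "(\<lambda>\<omega>. restrict (free_path W c X \<omega>) {0..}) \<in> measurable M (PiM {0..} (\<lambda>_. borel))"
    by (rule measurable_restrict) (simp add: free_path_def)
qed

lemma measurable_free_path_restrict:
  "X \<in> borel_measurable (F 0) \<Longrightarrow>
    (\<lambda>\<omega>. restrict (free_path W c X \<omega>) {0..}) \<in> measurable M (PiM {0..} (\<lambda>_. borel))"
  by (rule measurable_compose[OF measurable_free_path measurable_path_restrict])

text \<open>The factor at time 0, constantly 1 if \<open>0 \<notin> J\<close>, brings the integral into the form treated by
  \<open>free_path_finite_dim\<close>.\<close>

lemma emeasure_free_path_cylinder:
  fixes A :: "real \<Rightarrow> real set"
  assumes X: "X \<in> borel_measurable (F 0)" and J: "finite J" "J \<subseteq> {0..}" and A: "\<And>i. A i \<in> sets borel"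
  shows "emeasure (distr M (PiM {0..} (\<lambda>_. borel)) (\<lambda>\<omega>. restrict (free_path W c X \<omega>) {0..}))
      (prod_emb {0..} (\<lambda>_. borel) J (Pi\<^sub>E J A)) =
    (\<integral>\<^sup>+ \<omega>. (\<Prod>i\<in>insert 0 (J - {0}). (if i \<in> J then indicator (A i) else (\<lambda>_. 1)) (free_path W c X \<omega> i)) \<partial>M)"
proof -
  let ?R = "\<lambda>y. restrict y {0..} :: real \<Rightarrow> real" and ?P = "PiM {0..} (\<lambda>_. borel) :: (real \<Rightarrow> real) measure"
  let ?E = "prod_emb {0..} (\<lambda>_. borel :: real measure) J (Pi\<^sub>E J A)"
  have E: "?E \<in> sets ?P" using J A by (intro sets_PiM_I) auto
  have "emeasure (distr M ?P (\<lambda>\<omega>. ?R (free_path W c X \<omega>))) ?E = (\<integral>\<^sup>+ y. indicator ?E y \<partial>distr M ?P (\<lambda>\<omega>. ?R (free_path W c X \<omega>)))"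
    using E by simp
  also have "\<dots> = (\<integral>\<^sup>+ \<omega>. indicator ?E (?R (free_path W c X \<omega>)) \<partial>M)"
    using E by (intro nn_integral_distr measurable_free_path_restrict X) auto
  also have "\<dots> = (\<integral>\<^sup>+ \<omega>. (\<Prod>i\<in>insert 0 (J - {0}). (if i \<in> J then indicator (A i) else (\<lambda>_. 1)) (free_path W c X \<omega> i)) \<partial>M)"
  proof (rule nn_integral_cong)
    fix \<omega>
    have "?R (free_path W c X \<omega>) \<in> ?E \<longleftrightarrow> (\<forall>i\<in>J. free_path W c X \<omega> i \<in> A i)"
      using J by (auto simp: prod_emb_def PiE_iff subset_iff extensional_def)
    moreover have "(\<Prod>i\<in>insert 0 (J - {0}). (if i \<in> J then indicator (A i) else (\<lambda>_. 1)) (free_path W c X \<omega> i)) =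
        (\<Prod>i\<in>J. indicator (A i) (free_path W c X \<omega> i) :: ennreal)"
      using J by (intro prod.mono_neutral_cong_right) auto
    moreover have "\<dots> = indicator {\<omega>. \<forall>i\<in>J. free_path W c X \<omega> i \<in> A i} \<omega>"
      using J(1) by (auto simp: indicator_def prod_zero_iff intro!: prod.neutral)
    ultimately show "indicator ?E (?R (free_path W c X \<omega>)) =
        (\<Prod>i\<in>insert 0 (J - {0}). (if i \<in> J then indicator (A i) else (\<lambda>_. 1)) (free_path W c X \<omega> i) :: ennreal)"
      by (simp add: indicator_def)
  qed
  finally show ?thesis .
qed

text \<open>Equal finite-dimensional distributions give equal laws on the product space of all functions on
  \<open>[0, \<infinity>)\<close>. Every measurable set of continuous paths is the trace of a measurable set of the
  product space, so the laws on \<open>path_space\<close> agree as well.\<close>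

lemma free_path_law_symmetric:
  assumes X: "X \<in> borel_measurable (F 0)" "X' \<in> borel_measurable (F 0)" and eq: "distr M borel X = distr M borel X'"
  shows "distr M path_space (free_path W c X) = distr M path_space (free_path W (- c) X')"
proof -
  let ?R = "\<lambda>y. restrict y {0..} :: real \<Rightarrow> real" and ?P = "PiM {0..} (\<lambda>_. borel) :: (real \<Rightarrow> real) measure"
  have PiM_eq: "distr M ?P (\<lambda>\<omega>. ?R (free_path W c X \<omega>)) = distr M ?P (\<lambda>\<omega>. ?R (free_path W (- c) X' \<omega>))"
  proof (rule measure_eqI_PiM_infinite)
    fix A' :: "real \<Rightarrow> real set" and J :: "real set"
    assume J: "finite J" "J \<subseteq> {0..}" and A': "\<And>i. i \<in> J \<Longrightarrow> A' i \<in> sets borel"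
    \<comment> \<open>Replacing the irrelevant factors outside \<open>J\<close> makes every factor measurable.\<close>
    define A where "A i = (if i \<in> J then A' i else {})" for i
    have A: "A i \<in> sets borel" for i using A' by (simp add: A_def)
    have PiE_A: "Pi\<^sub>E J A' = Pi\<^sub>E J A" by (intro PiE_cong) (simp add: A_def)
    have J': "finite (J - {0})" "J - {0} \<subseteq> {0<..}" using J by (auto simp: less_le)
    have "(if i \<in> J then indicator (A i) else (\<lambda>_. 1 :: ennreal)) \<in> borel_measurable borel" for i
      using A by auto
    from free_path_finite_dim[OF X eq J', where c=c and g="\<lambda>i. if i \<in> J then indicator (A i) else (\<lambda>_. 1)", OF this]
    show "emeasure (distr M ?P (\<lambda>\<omega>. ?R (free_path W c X \<omega>))) (prod_emb {0..} (\<lambda>_. borel) J (Pi\<^sub>E J A')) =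
      emeasure (distr M ?P (\<lambda>\<omega>. ?R (free_path W (- c) X' \<omega>))) (prod_emb {0..} (\<lambda>_. borel) J (Pi\<^sub>E J A'))"
      unfolding PiE_A emeasure_free_path_cylinder[OF X(1) J A] emeasure_free_path_cylinder[OF X(2) J A] .
  next
    show "finite_measure (distr M ?P (\<lambda>\<omega>. ?R (free_path W c X \<omega>)))"
      using prob_space_distr[OF measurable_free_path_restrict[OF X(1)]] by (simp add: prob_space_def)
  qed simp_all
  show ?thesis
  proof (rule measure_eqI)
    fix S assume "S \<in> sets (distr M path_space (free_path W c X))"
    then obtain B where B: "B \<in> sets ?P" "S = ?R -` B \<inter> {y. continuous_on {0..} y}"
      unfolding sets_distr path_space_def by (subst (asm) sets_vimage_algebra2) (auto simp: space_PiM)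
    have "emeasure (distr M path_space (free_path W c X)) S = emeasure (distr M ?P (\<lambda>\<omega>. ?R (free_path W c X \<omega>))) B"
      if X: "X \<in> borel_measurable (F 0)" for c X
    proof -
      have S: "S \<in> sets path_space" using in_vimage_algebra[OF B(1)] by (simp add: B(2) path_space_def)
      have "free_path W c X -` S \<inter> space M = (\<lambda>\<omega>. ?R (free_path W c X \<omega>)) -` B \<inter> space M"
        using measurable_space[OF measurable_free_path[OF X]] B(2) by auto
      then show ?thesis using S B(1) by (simp add: emeasure_distr measurable_free_path[OF X] measurable_free_path_restrict[OF X])
    qed
    then show "emeasure (distr M path_space (free_path W c X)) S = emeasure (distr M path_space (free_path W (- c) X')) S"
      using X PiM_eq by simp
  qed simp
qed

section \<open>Symmetric strategies and the mean of the controlled state\<close>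

lemma reflect_free_path: "(\<lambda>t. c - free_path W \<sigma> X \<omega> t) = free_path W (- \<sigma>) (\<lambda>\<omega>. c - X \<omega>) \<omega>"
  by (simp add: free_path_def fun_eq_iff)

lemma reflected_start_measurable: "X \<in> borel_measurable (F 0) \<Longrightarrow> (\<lambda>\<omega>. c - X \<omega> :: real) \<in> borel_measurable (F 0)"
  by simp

text \<open>The following three transfer principles let \<open>X'\<close> differ from \<open>X\<close> in order to cover two cases: the
  path started from the initial distribution (\<open>X' = X\<close>), and deterministic starts, where \<open>x\<close> is
  moved to \<open>c - x\<close>. Measurability of \<open>P\<close> in the path is essential: the exceptional null set for one
  path process says nothing about the other one unless it is described in terms of the path.\<close>

lemma AE_reflect_free_path:
  assumes X: "X \<in> borel_measurable (F 0)" "X' \<in> borel_measurable (F 0)"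
    and eq: "distr M borel (\<lambda>\<omega>. c - X \<omega>) = distr M borel X'"
    and P: "{y \<in> space path_space. P y} \<in> sets path_space"
  shows "(AE \<omega> in M. P (\<lambda>t. c - free_path W \<sigma> X \<omega> t)) \<longleftrightarrow> (AE \<omega> in M. P (free_path W \<sigma> X' \<omega>))"
proof -
  note X1 = reflected_start_measurable[OF X(1), of c]
  have "(AE \<omega> in M. P (free_path W (- \<sigma>) (\<lambda>\<omega>. c - X \<omega>) \<omega>)) \<longleftrightarrow>
      (AE y in distr M path_space (free_path W (- \<sigma>) (\<lambda>\<omega>. c - X \<omega>)). P y)"
    by (rule AE_distr_iff[OF measurable_free_path[OF X1] P, symmetric])
  also have "\<dots> \<longleftrightarrow> (AE y in distr M path_space (free_path W \<sigma> X'). P y)"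
    unfolding free_path_law_symmetric[OF X1 X(2) eq, of "-\<sigma>", unfolded minus_minus] ..
  also have "\<dots> \<longleftrightarrow> (AE \<omega> in M. P (free_path W \<sigma> X' \<omega>))"
    by (rule AE_distr_iff[OF measurable_free_path[OF X(2)] P])
  finally show ?thesis by (simp only: reflect_free_path)
qed

lemma nn_integral_reflect_free_path:
  assumes X: "X \<in> borel_measurable (F 0)" "X' \<in> borel_measurable (F 0)"
    and eq: "distr M borel (\<lambda>\<omega>. c - X \<omega>) = distr M borel X'"
    and G: "G \<in> borel_measurable path_space"
  shows "(\<integral>\<^sup>+ \<omega>. G (\<lambda>t. c - free_path W \<sigma> X \<omega> t) \<partial>M) = (\<integral>\<^sup>+ \<omega>. G (free_path W \<sigma> X' \<omega>) \<partial>M)"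
proof -
  note X1 = reflected_start_measurable[OF X(1), of c]
  show ?thesis
    using free_path_law_symmetric[OF X1 X(2) eq, of "-\<sigma>"]
      nn_integral_distr[OF measurable_free_path[OF X1, of "-\<sigma>"], of G]
      nn_integral_distr[OF measurable_free_path[OF X(2), of \<sigma>], of G] G
    by (simp add: reflect_free_path)
qed

lemma integral_reflect_free_path:
  fixes G :: "(real \<Rightarrow> real) \<Rightarrow> real"
  assumes X: "X \<in> borel_measurable (F 0)" "X' \<in> borel_measurable (F 0)"
    and eq: "distr M borel (\<lambda>\<omega>. c - X \<omega>) = distr M borel X'"
    and G: "G \<in> borel_measurable path_space"
  shows "integrable M (\<lambda>\<omega>. G (\<lambda>t. c - free_path W \<sigma> X \<omega> t)) \<longleftrightarrow> integrable M (\<lambda>\<omega>. G (free_path W \<sigma> X' \<omega>))"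
    and "(\<integral> \<omega>. G (\<lambda>t. c - free_path W \<sigma> X \<omega> t) \<partial>M) = (\<integral> \<omega>. G (free_path W \<sigma> X' \<omega>) \<partial>M)"
proof -
  note X1 = reflected_start_measurable[OF X(1), of c]
  note law = free_path_law_symmetric[OF X1 X(2) eq, of "-\<sigma>"]
  show "integrable M (\<lambda>\<omega>. G (\<lambda>t. c - free_path W \<sigma> X \<omega> t)) \<longleftrightarrow> integrable M (\<lambda>\<omega>. G (free_path W \<sigma> X' \<omega>))"
    using law integrable_distr_eq[OF measurable_free_path[OF X1, of "-\<sigma>"] G]
      integrable_distr_eq[OF measurable_free_path[OF X(2), of \<sigma>] G]
    by (simp add: reflect_free_path)
  show "(\<integral> \<omega>. G (\<lambda>t. c - free_path W \<sigma> X \<omega> t) \<partial>M) = (\<integral> \<omega>. G (free_path W \<sigma> X' \<omega>) \<partial>M)"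
    using law integral_distr[OF measurable_free_path[OF X1, of "-\<sigma>"] G]
      integral_distr[OF measurable_free_path[OF X(2), of \<sigma>] G]
    by (simp add: reflect_free_path)
qed

lemma admissible_reflect:
  assumes X0: "X0 \<in> borel_measurable (F 0)" "distr M borel (\<lambda>\<omega>. c - X0 \<omega>) = distr M borel X0"
    and u: "u \<in> admissible M W X0 \<sigma>"
  shows "reflect_control c u \<in> admissible M W X0 \<sigma>"
proof -
  have A: "closed (fst u)" and \<xi> [measurable]: "snd u \<in> borel_measurable borel"
    and int: "\<And>t. 0 \<le> t \<Longrightarrow> integrable M (\<lambda>\<omega>. state u (free_path W \<sigma> X0 \<omega>) t)"
    using u by (auto simp: admissible_def)
  have "closed ((\<lambda>x. c - x) -` fst u)" by (intro closed_vimage A continuous_intros)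
  then have "closed (fst (reflect_control c u))" by (simp add: reflect_control_def vimage_def)
  moreover have "snd (reflect_control c u) \<in> borel_measurable borel"
    by (simp add: reflect_control_def)
  moreover have "AE \<omega> in M. well_posed (reflect_control c u) (free_path W \<sigma> (\<lambda>_. x) \<omega>)" for x
    using AE_reflect_free_path[of "\<lambda>_. x" "\<lambda>_. c - x" c "well_posed u" \<sigma>] well_posed_sets[OF A \<xi>] u
    by (simp add: well_posed_reflect admissible_def)
  moreover have "AE \<omega> in M. well_posed (reflect_control c u) (free_path W \<sigma> X0 \<omega>)"
    using AE_reflect_free_path[OF X0(1) X0 well_posed_sets[OF A \<xi>], of \<sigma>] u
    by (simp add: well_posed_reflect admissible_def)
  moreover have "integrable M (\<lambda>\<omega>. state (reflect_control c u) (free_path W \<sigma> X0 \<omega>) t)" if "0 \<le> t" for t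
    using integral_reflect_free_path(1)[OF X0(1) X0 measurable_state[OF A \<xi> that], of \<sigma>] int[OF that]
    by (simp add: state_reflect)
  ultimately show ?thesis by (simp add: admissible_def)
qed

lemma cost_reflect:
  assumes u: "closed (fst u)" "snd u \<in> borel_measurable borel"
    and meas: "(\<lambda>x. f x m) \<in> borel_measurable borel" "\<phi> \<in> borel_measurable borel"
    and sym: "\<And>x. f (c - x) m = f x m" "\<And>\<xi>. \<phi> (- \<xi>) = \<phi> \<xi>"
  shows "cost M W \<sigma> r f \<phi> x (reflect_control c u) m = cost M W \<sigma> r f \<phi> (c - x) u m"
  unfolding cost_def path_cost_reflect[of f c m \<phi>, OF sym]
  by (rule nn_integral_reflect_free_path[OF _ _ _ measurable_path_cost[where f=f and m=m, OF u meas]]) simp_all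

text \<open>Reflection maps admissible strategies for a start at \<open>x\<close> to admissible strategies of the same cost
  for a start at \<open>c - x\<close>. This gives one inequality; the other one is its instance at \<open>c - x\<close>.\<close>

lemma value_fun_reflect:
  assumes X0: "X0 \<in> borel_measurable (F 0)" "distr M borel (\<lambda>\<omega>. c - X0 \<omega>) = distr M borel X0"
    and meas: "(\<lambda>x. f x m) \<in> borel_measurable borel" "\<phi> \<in> borel_measurable borel"
    and sym: "\<And>x. f (c - x) m = f x m" "\<And>\<xi>. \<phi> (- \<xi>) = \<phi> \<xi>"
  shows "value_fun M W X0 \<sigma> r f \<phi> (c - x) m = value_fun M W X0 \<sigma> r f \<phi> x m"
proof -
  have le: "value_fun M W X0 \<sigma> r f \<phi> (c - x) m \<le> value_fun M W X0 \<sigma> r f \<phi> x m" for x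
    unfolding value_fun_def[of _ _ _ _ _ _ _ x]
  proof (rule INF_greatest)
    fix u assume u: "u \<in> admissible M W X0 \<sigma>"
    then have "cost M W \<sigma> r f \<phi> (c - x) (reflect_control c u) m = cost M W \<sigma> r f \<phi> x u m"
      using cost_reflect[of u f m \<phi> c \<sigma> r "c - x"] meas sym by (simp add: admissible_def)
    then show "value_fun M W X0 \<sigma> r f \<phi> (c - x) m \<le> cost M W \<sigma> r f \<phi> x u m"
      unfolding value_fun_def using INF_lower[OF admissible_reflect[OF X0 u]] by metis
  qed
  show ?thesis using le[of x] le[of "c - x"] by simp
qed

lemma optimal_reflect:
  assumes X0: "X0 \<in> borel_measurable (F 0)" "distr M borel (\<lambda>\<omega>. c - X0 \<omega>) = distr M borel X0"
    and meas: "(\<lambda>x. f x m) \<in> borel_measurable borel" "\<phi> \<in> borel_measurable borel"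
    and sym: "\<And>x. f (c - x) m = f x m" "\<And>\<xi>. \<phi> (- \<xi>) = \<phi> \<xi>"
    and u: "u \<in> admissible M W X0 \<sigma>" "optimal M W X0 \<sigma> r f \<phi> u m"
  shows "optimal M W X0 \<sigma> r f \<phi> (reflect_control c u) m"
  unfolding optimal_def
proof
  fix x
  have "value_fun M W X0 \<sigma> r f \<phi> x m = value_fun M W X0 \<sigma> r f \<phi> (c - x) m"
    using value_fun_reflect[of X0 c f m \<phi>] X0 meas sym by simp
  also have "\<dots> = cost M W \<sigma> r f \<phi> (c - x) u m" using u(2) by (simp add: optimal_def)
  also have "\<dots> = cost M W \<sigma> r f \<phi> x (reflect_control c u) m"
    using cost_reflect[of u f m \<phi> c] u(1) meas sym by (simp add: admissible_def)
  finally show "value_fun M W X0 \<sigma> r f \<phi> x m = cost M W \<sigma> r f \<phi> x (reflect_control c u) m" .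
qed

text \<open>If the strategy is its own mirror image, then the mean \<open>e\<close> of the state satisfies
  \<open>e = 2 m - e\<close>: applying the mirror strategy changes nothing, and it amounts to
  reflecting the state controlled along the mirror path, which has the same law.\<close>

lemma mean_state_of_symmetric_strategy:
  assumes X0: "X0 \<in> borel_measurable (F 0)" "distr M borel (\<lambda>\<omega>. 2 * m - X0 \<omega>) = distr M borel X0"
    and u: "u \<in> admissible M W X0 \<sigma>" and same: "same_strategy (reflect_control (2 * m) u) u"
    and t: "0 \<le> t"
  shows "(\<integral> \<omega>. state u (free_path W \<sigma> X0 \<omega>) t \<partial>M) = m"
proof -
  have A: "closed (fst u)" and \<xi>: "snd u \<in> borel_measurable borel"
    and int: "integrable M (\<lambda>\<omega>. state u (free_path W \<sigma> X0 \<omega>) t)"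
    using u t by (auto simp: admissible_def)
  note meas = measurable_state[OF A \<xi> t]
  have "(\<integral> \<omega>. state u (free_path W \<sigma> X0 \<omega>) t \<partial>M) =
      (\<integral> \<omega>. state (reflect_control (2 * m) u) (free_path W \<sigma> X0 \<omega>) t \<partial>M)"
  proof (rule Bochner_Integration.integral_cong[OF refl])
    fix \<omega> assume "\<omega> \<in> space M"
    then have "continuous_on {0..} (free_path W \<sigma> X0 \<omega>)"
      using measurable_space[OF measurable_free_path[OF X0(1)]] by auto
    from same_strategy_state[OF this A same]
    show "state u (free_path W \<sigma> X0 \<omega>) t = state (reflect_control (2 * m) u) (free_path W \<sigma> X0 \<omega>) t"
      by simp
  qed
  also have "\<dots> = 2 * m - (\<integral> \<omega>. state u (\<lambda>t. 2 * m - free_path W \<sigma> X0 \<omega> t) t \<partial>M)"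
    using integral_reflect_free_path(1)[OF X0(1) X0 meas, of \<sigma>] int
    by (simp add: state_reflect prob_space)
  also have "\<dots> = 2 * m - (\<integral> \<omega>. state u (free_path W \<sigma> X0 \<omega>) t \<partial>M)"
    using integral_reflect_free_path(2)[OF X0(1) X0 meas, of \<sigma>] by simp
  finally show ?thesis by simp
qed

end

theorem theorem3p3:
  fixes M :: "'a measure" and F :: "real \<Rightarrow> 'a measure" and W :: "real \<Rightarrow> 'a \<Rightarrow> real"
    and X0 :: "'a \<Rightarrow> real" and \<mu> :: "real measure" and r \<sigma> :: real
    and f :: "real \<Rightarrow> real \<Rightarrow> real" and \<phi> :: "real \<Rightarrow> real"
  assumes BM: "adapted_brownian_motion M F W"
    and X0: "X0 \<in> borel_measurable (F 0)" "distr M borel X0 = \<mu>"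
    and r: "r > 0"
    and A1: "\<sigma> > 0" "real_distribution \<mu>" "integrable \<mu> (\<lambda>x. \<bar>x\<bar>)"
      "distr \<mu> borel (\<lambda>x. 2 * (\<integral>y. y \<partial>\<mu>) - x) = \<mu>"
    and A2: "bdd_below (range \<phi>)" "(INF \<xi>. \<phi> \<xi>) > 0"
      "continuous_on (UNIV - {0}) \<phi>"
      "filterlim \<phi> at_top at_infinity"
      "\<exists>k>0. \<forall>\<xi>. \<phi> \<xi> / (1 + \<bar>\<xi>\<bar>) \<le> k"
      "\<forall>\<xi>1 \<xi>2. \<phi> \<xi>1 + \<phi> \<xi>2 \<ge> \<phi> (\<xi>1 + \<xi>2) + (INF \<xi>. \<phi> \<xi>)"
      "\<forall>\<xi>. \<phi> (- \<xi>) = \<phi> \<xi>"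
    and A3: "continuous_on UNIV (\<lambda>(x, m). f x m)"
      "\<forall>x m. f x m \<ge> 0"
      "\<forall>m. \<exists>C>0. \<forall>x y. x \<noteq> y \<longrightarrow> \<bar>f x m - f y m\<bar> < C * \<bar>x - y\<bar>"
      "\<forall>m \<delta>. f (m + \<delta>) m = f (m - \<delta>) m"
    and A4: "\<forall>m. \<exists>u. is_intervention_strategy \<phi> (\<lambda>x. value_fun M W X0 \<sigma> r f \<phi> x m) u \<and>
      u \<in> admissible M W X0 \<sigma> \<and> optimal M W X0 \<sigma> r f \<phi> u m \<and>
      (\<forall>v \<in> admissible M W X0 \<sigma>. optimal M W X0 \<sigma> r f \<phi> v m \<longrightarrow> same_strategy v u)"
  shows "\<exists>u m. mfg_solution M W X0 \<sigma> r f \<phi> u m"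
proof -
  interpret adapted_brownian_motion M F W by (rule BM)
  define m where "m = (\<integral>y. y \<partial>\<mu>)"
  obtain u where u: "u \<in> admissible M W X0 \<sigma>" "optimal M W X0 \<sigma> r f \<phi> u m"
    and unique: "\<And>v. v \<in> admissible M W X0 \<sigma> \<Longrightarrow> optimal M W X0 \<sigma> r f \<phi> v m \<Longrightarrow> same_strategy v u"
    using A4 by blast
  have "X0 \<in> borel_measurable M" using F_measurable X0(1) by blast
  then have law: "distr M borel (\<lambda>\<omega>. 2 * m - X0 \<omega>) = distr M borel X0"
    using A1(4) by (simp add: X0(2)[symmetric] distr_distr comp_def m_def)
  have "continuous_on UNIV (\<lambda>x. f x m)"
    using continuous_on_compose2[OF A3(1), OF continuous_on_Pair[OF continuous_on_id continuous_on_const[of _ m]]] by simp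
  then have f: "(\<lambda>x. f x m) \<in> borel_measurable borel" by (rule borel_measurable_continuous_onI)
  have \<phi>: "\<phi> \<in> borel_measurable borel"
    using A2(3) by (intro borel_measurable_continuous_countable_exceptions[of "{0}"]) (auto simp: Compl_eq_Diff_UNIV)
  have f_sym: "f (2 * m - x) m = f x m" for x
    using A3(4)[rule_format, of m "m - x"] by (simp add: algebra_simps)
  note sym = f_sym A2(7)[rule_format]
  have "same_strategy (reflect_control (2 * m) u) u"
    using unique[OF admissible_reflect[OF X0(1) law u(1)]
        optimal_reflect[where f=f and m=m, OF X0(1) law f \<phi> sym u]] .
  then have mean: "(\<integral> \<omega>. state u (free_path W \<sigma> X0 \<omega>) t \<partial>M) = m" if "0 \<le> t" for t
    using mean_state_of_symmetric_strategy[OF X0(1) law u(1)] that by simp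
  have "((\<lambda>t. ereal (\<integral> \<omega>. state u (free_path W \<sigma> X0 \<omega>) t \<partial>M)) \<longlongrightarrow> ereal m) at_top"
    using mean by (intro tendsto_eventually eventually_mono[OF eventually_ge_at_top[of 0]]) simp
  then have "Limsup at_top (\<lambda>t. ereal (\<integral> \<omega>. state u (free_path W \<sigma> X0 \<omega>) t \<partial>M)) = ereal m"
    by (rule lim_imp_Limsup[OF trivial_limit_at_top_linorder])
  with u have "mfg_solution M W X0 \<sigma> r f \<phi> u m" by (simp add: mfg_solution_def)
  then show ?thesis by blast
qed

end
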